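(* Let $\mathbb{X}=\ell_1^n$ (real, $n\ge 1$). (i) If a linear operator $T:\mathbb{X}\to\mathbb{X}$ preserves Birkhoff-James orthogonality at all extreme points of the unit ball $B_{\mathbb{X}}$, then $T$ is a scalar multiple of an isometry. (ii) $\kappa(\mathbb{X})=n$.
   Context: $\ell_1^n$ is $\mathbb{R}^n$ with the norm $\|x\|=\sum_i|x_i|$. For $x,y\in\mathbb{X}$, $x\perp_B y$ (Birkhoff-James orthogonality) means $\|x+\lambda y\|\ge\|x\|$ for all scalars $\lambda$. $T$ preserves Birkhoff-James orthogonality at $x$ if for every $y\in\mathbb{X}$, $x\perp_B y$ implies $Tx\perp_B Ty$. An isometry is a linear operator $S$ with $\|Sx\|=\|x\|$ for all $x$; scalar multiples include the zero multiple. A nonempty subset $A$ of the unit sphere $S_{\mathbb{X}}$ is a $\mathcal{K}$-set if every bounded linear operator on $\mathbb{X}$ that preserves Birkhoff-James orthogonality at each point of $A$ is a scalar multiple of an isometry. For a Banach space $\mathbb{X}$ having a finite $\mathcal{K}$-set, $\kappa(\mathbb{X})=\min\{|A|: A \text{ is a } \mathcal{K}\text{-set of } \mathbb{X}\}$; in particular (ii) includes the assertion that a finite $\mathcal{K}$-set exists. *)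

theory Defs
  imports "HOL-Analysis.Analysis"
begin

text \<open>
  A copy of \<^typ>\<open>real ^ 'n\<close>, because the norm of that type is already fixed as the Euclidean one.
  The dimension is \<open>CARD('n)\<close>.
\<close>

typedef (overloaded) 'n l1 = "UNIV :: (real ^ 'n::finite) set"
  morphisms vec_of_l1 l1_of_vec
  by simp

setup_lifting type_definition_l1

instantiation l1 :: (finite) real_normed_vector
begin

lift_definition zero_l1 :: "'a l1" is "0" .
lift_definition plus_l1 :: "'a l1 \<Rightarrow> 'a l1 \<Rightarrow> 'a l1" is "(+)" .
lift_definition minus_l1 :: "'a l1 \<Rightarrow> 'a l1 \<Rightarrow> 'a l1" is "(-)" .
lift_definition uminus_l1 :: "'a l1 \<Rightarrow> 'a l1" is "uminus" .
lift_definition scaleR_l1 :: "real \<Rightarrow> 'a l1 \<Rightarrow> 'a l1" is "scaleR" .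
lift_definition norm_l1 :: "'a l1 \<Rightarrow> real" is "\<lambda>x. \<Sum>i\<in>UNIV. \<bar>x $ i\<bar>" .

definition sgn_l1 :: "'a l1 \<Rightarrow> 'a l1"
  where "sgn_l1 x = inverse (norm x) *\<^sub>R x"

definition dist_l1 :: "'a l1 \<Rightarrow> 'a l1 \<Rightarrow> real"
  where "dist_l1 x y = norm (x - y)"

definition uniformity_l1 :: "('a l1 \<times> 'a l1) filter"
  where "uniformity_l1 = (INF e\<in>{0<..}. principal {(x, y). dist x y < e})"

definition open_l1 :: "'a l1 set \<Rightarrow> bool"
  where "open_l1 U \<longleftrightarrow> (\<forall>x\<in>U. \<forall>\<^sub>F (x', y) in uniformity. x' = x \<longrightarrow> y \<in> U)"

instance
proof
  fix a b :: real and x y z :: "'a l1"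
  show "x + y + z = x + (y + z)" by transfer (simp add: add.assoc)
  show "x + y = y + x" by transfer (simp add: add.commute)
  show "0 + x = x" by transfer simp
  show "- x + x = 0" by transfer simp
  show "x - y = x + - y" by transfer simp
  show "a *\<^sub>R (x + y) = a *\<^sub>R x + a *\<^sub>R y" by transfer (simp add: scaleR_add_right)
  show "(a + b) *\<^sub>R x = a *\<^sub>R x + b *\<^sub>R x" by transfer (simp add: scaleR_add_left)
  show "a *\<^sub>R b *\<^sub>R x = (a * b) *\<^sub>R x" by transfer simp
  show "1 *\<^sub>R x = x" by transfer simp
  show "norm x = 0 \<longleftrightarrow> x = 0"
    by transfer (simp add: sum_nonneg_eq_0_iff vec_eq_iff)
  show "norm (x + y) \<le> norm x + norm y"
    by transfer (simp add: sum.distrib[symmetric] sum_mono)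
  show "norm (a *\<^sub>R x) = \<bar>a\<bar> * norm x"
    by transfer (simp add: abs_mult sum_distrib_left)
qed (fact sgn_l1_def dist_l1_def uniformity_l1_def open_l1_def)+

end

definition bj_orthogonal :: "'a::real_normed_vector \<Rightarrow> 'a \<Rightarrow> bool"  (infix "\<bottom>\<^sub>B" 50)
  where "x \<bottom>\<^sub>B y \<longleftrightarrow> (\<forall>c::real. norm (x + c *\<^sub>R y) \<ge> norm x)"

definition preserves_bj_at :: "('a::real_normed_vector \<Rightarrow> 'a) \<Rightarrow> 'a \<Rightarrow> bool"
  where "preserves_bj_at T x \<longleftrightarrow> (\<forall>y. x \<bottom>\<^sub>B y \<longrightarrow> T x \<bottom>\<^sub>B T y)"

definition linear_isometry :: "('a::real_normed_vector \<Rightarrow> 'a) \<Rightarrow> bool"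
  where "linear_isometry S \<longleftrightarrow> linear S \<and> (\<forall>x. norm (S x) = norm x)"

definition scalar_multiple_of_isometry :: "('a::real_normed_vector \<Rightarrow> 'a) \<Rightarrow> bool"
  where "scalar_multiple_of_isometry T \<longleftrightarrow>
    (\<exists>(c::real) S. linear_isometry S \<and> T = (\<lambda>x. c *\<^sub>R S x))"

definition K_set :: "'a::real_normed_vector set \<Rightarrow> bool"
  where "K_set A \<longleftrightarrow> A \<noteq> {} \<and> A \<subseteq> sphere 0 1 \<and>
    (\<forall>T. bounded_linear T \<and> (\<forall>x\<in>A. preserves_bj_at T x) \<longrightarrow> scalar_multiple_of_isometry T)"

text \<open>Meaningful only if the space has a finite \<open>K_set\<close>.\<close>

definition kappa :: "'a::real_normed_vector itself \<Rightarrow> nat"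
  where "kappa _ = (LEAST m. \<exists>A::'a set. K_set A \<and> finite A \<and> card A = m)"

end

theory Submission
  imports Defs
begin

text \<open>
  Why the theorem is true. Write \<open>e\<^sub>i\<close> for the standard unit vectors.  For \<open>i \<noteq> j\<close> and either
  sign, \<open>e\<^sub>i \<bottom>\<^sub>B e\<^sub>i \<plusminus> e\<^sub>j\<close>.  Suppose that \<open>T\<close> carries these relations over to the images
  \<open>v\<^sub>i = T e\<^sub>i\<close>.  The competitor \<open>v\<^sub>i - (v\<^sub>i + v\<^sub>j) = - v\<^sub>j\<close> gives \<open>\<parallel>v\<^sub>i\<parallel> \<le> \<parallel>v\<^sub>j\<parallel>\<close>, so by symmetry all
  the \<open>v\<^sub>i\<close> have one common norm \<open>r\<close>.  The competitor \<open>v\<^sub>i - (v\<^sub>i \<plusminus> v\<^sub>j) / 2\<close> then gives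
  \<open>\<parallel>v\<^sub>i \<plusminus> v\<^sub>j\<parallel> \<ge> 2 r\<close>, which is equality in the triangle inequality for both signs.  In the
  \<open>\<ell>\<^sub>1\<close> norm, equality for one sign makes the coordinates of \<open>v\<^sub>i\<close> and \<open>v\<^sub>j\<close> agree in sign, and
  equality for the other makes them disagree; so the supports are disjoint
  (\<open>disjoint_supports_if_norm_additive\<close>).  For vectors with pairwise disjoint supports the
  \<open>\<ell>\<^sub>1\<close> norm is additive, whence \<open>\<parallel>T x\<parallel> = r \<parallel>x\<parallel>\<close> for all \<open>x\<close>.

  This settles the first part, because the \<open>e\<^sub>i\<close> are extreme points of the ball, and it also
  shows that the \<open>e\<^sub>i\<close> form a \<open>K_set\<close> with \<open>n\<close> elements.  Conversely, fewer than \<open>n\<close> points are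
  all annihilated by some nonzero operator of rank one.  An operator preserves orthogonality
  trivially at every point of its kernel, but a nonzero operator whose kernel contains a unit
  vector is no multiple of an isometry (\<open>K_set_card_ge\<close>).
\<close>

section \<open>Coordinates and unit vectors\<close>

definition coord :: "'n::finite l1 \<Rightarrow> 'n \<Rightarrow> real"
  where "coord x i = vec_of_l1 x $ i"

definition unit_l1 :: "'n::finite \<Rightarrow> 'n l1"
  where "unit_l1 i = l1_of_vec (axis i 1)"

lemma coord_simps [simp]:
  "coord 0 i = 0"
  "coord (x + y) i = coord x i + coord y i"
  "coord (x - y) i = coord x i - coord y i"
  "coord (- x) i = - coord x i"
  "coord (c *\<^sub>R x) i = c * coord x i"
  by (simp_all add: coord_def zero_l1.rep_eq plus_l1.rep_eq minus_l1.rep_eq uminus_l1.rep_eq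
      scaleR_l1.rep_eq)

lemma coord_sum [simp]: "coord (sum f A) i = (\<Sum>a\<in>A. coord (f a) i)"
  by (induction A rule: infinite_finite_induct) auto

lemma coord_unit_l1 [simp]: "coord (unit_l1 i) j = (if i = j then 1 else 0)"
  by (simp add: coord_def unit_l1_def l1_of_vec_inverse axis_def)

lemma l1_eqI: "(\<And>i. coord x i = coord y i) \<Longrightarrow> x = y"
  by (metis coord_def vec_eq_iff vec_of_l1_inject)

lemma norm_l1: "norm x = (\<Sum>i\<in>UNIV. \<bar>coord x i\<bar>)"
  by (simp add: norm_l1.rep_eq coord_def)

lemma abs_coord_le_norm: "\<bar>coord x i\<bar> \<le> norm x"
  unfolding norm_l1 by (rule member_le_sum) auto

lemma norm_unit_l1 [simp]: "norm (unit_l1 i) = 1"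
  by (simp add: norm_l1 if_distrib cong: if_cong)

lemma inj_unit_l1: "inj unit_l1"
  by (rule injI) (metis coord_unit_l1 zero_neq_one)

lemma unit_l1_expansion: "(\<Sum>i\<in>UNIV. coord x i *\<^sub>R unit_l1 i) = x"
  by (rule l1_eqI) (simp add: if_distrib cong: if_cong)

text \<open>
  On the ball the \<open>i\<close>-th coordinate is at most \<open>1\<close>, and it equals \<open>1\<close> only at \<open>e\<^sub>i\<close>, because the
  other coordinates then have no norm left; so \<open>e\<^sub>i\<close> is the unique maximiser of a linear functional.
\<close>

lemma unit_l1_extreme_point: "unit_l1 i extreme_point_of cball 0 1"
proof -
  have eq_unit: "x = unit_l1 i" if n: "norm x \<le> 1" and xi: "coord x i = 1" for x :: "'a l1"
  proof (rule l1_eqI)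
    fix j
    have "norm x = 1 + (\<Sum>j\<in>UNIV - {i}. \<bar>coord x j\<bar>)"
      unfolding norm_l1 by (subst sum.remove[of _ i]) (auto simp: xi)
    then have "(\<Sum>j\<in>UNIV - {i}. \<bar>coord x j\<bar>) \<le> 0"
      using n by simp
    then have "\<bar>coord x j\<bar> \<le> 0" if "j \<noteq> i"
      using that member_le_sum[of j "UNIV - {i}" "\<lambda>j. \<bar>coord x j\<bar>"] by auto
    then show "coord x j = coord (unit_l1 i) j"
      using xi by auto
  qed
  have False
    if a: "norm a \<le> 1" and b: "norm b \<le> 1" and mem: "unit_l1 i \<in> open_segment a b"
    for a b :: "'a l1"
  proof -
    obtain u where ab: "a \<noteq> b" and u: "0 < u" "u < 1"
      and eq: "unit_l1 i = (1 - u) *\<^sub>R a + u *\<^sub>R b"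
      using mem by (auto simp: in_segment)
    have sum1: "1 = (1 - u) * coord a i + u * coord b i"
      using arg_cong[OF eq, of "\<lambda>x. coord x i"] by simp
    have ai: "coord a i \<le> 1" and bi: "coord b i \<le> 1"
      using abs_coord_le_norm[of a i] abs_coord_le_norm[of b i] a b by linarith+
    have "(1 - u) * (1 - coord a i) + u * (1 - coord b i) = 0"
      using sum1 by (simp add: algebra_simps)
    moreover have "(1 - u) * (1 - coord a i) \<ge> 0" "u * (1 - coord b i) \<ge> 0"
      using u ai bi by simp_all
    ultimately have "(1 - u) * (1 - coord a i) = 0" "u * (1 - coord b i) = 0"
      by linarith+
    then have "coord a i = 1" "coord b i = 1"
      using u by auto
    then show False
      using eq_unit a b ab by metis
  qed
  then show ?thesis
    by (auto simp: extreme_point_of_def)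
qed


section \<open>Disjoint supports\<close>

text \<open>
  If the sum has maximal norm then no coordinate suffers cancellation, so corresponding
  coordinates have the same weak sign; applied to \<open>w\<close> and to \<open>- w\<close>, this leaves only products
  equal to zero.
\<close>

lemma disjoint_supports_if_norm_additive:
  fixes v w :: "'n::finite l1"
  assumes "norm v + norm w \<le> norm (v + w)" and "norm v + norm w \<le> norm (v - w)"
  shows "coord v k * coord w k = 0"
proof -
  have same_sign: "0 \<le> coord v k * coord w k"
    if add: "norm v + norm w \<le> norm (v + w)" for w :: "'n l1"
  proof -
    let ?d = "\<lambda>k. \<bar>coord v k\<bar> + \<bar>coord w k\<bar> - \<bar>coord v k + coord w k\<bar>"
    have "sum ?d UNIV \<le> 0"
      using add by (simp add: norm_l1 sum.distrib sum_subtractf)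
    moreover have "?d k \<le> sum ?d UNIV"
      by (rule member_le_sum) auto
    ultimately have "\<bar>coord v k\<bar> + \<bar>coord w k\<bar> \<le> \<bar>coord v k + coord w k\<bar>"
      by linarith
    then show ?thesis
      by (auto simp: zero_le_mult_iff)
  qed
  show ?thesis
    using same_sign[of w] same_sign[of "- w"] assms by simp
qed

lemma abs_sum_eq_sum_abs_if_products_zero:
  fixes f :: "'i \<Rightarrow> real"
  assumes "\<And>i j. i \<noteq> j \<Longrightarrow> f i * f j = 0"
  shows "\<bar>sum f A\<bar> = (\<Sum>i\<in>A. \<bar>f i\<bar>)"
proof (induction A rule: infinite_finite_induct)
  case (insert a A)
  have "f a * sum f A = 0"
    unfolding sum_distrib_left using assms insert.hyps by (intro sum.neutral) metis
  then show ?case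
    using insert by auto
qed auto

lemma norm_sum_disjoint_supports:
  fixes v :: "'i \<Rightarrow> 'n::finite l1"
  assumes "\<And>i j k. i \<noteq> j \<Longrightarrow> coord (v i) k * coord (v j) k = 0"
  shows "norm (\<Sum>i\<in>A. a i *\<^sub>R v i) = (\<Sum>i\<in>A. \<bar>a i\<bar> * norm (v i))"
proof -
  have "norm (\<Sum>i\<in>A. a i *\<^sub>R v i) = (\<Sum>k\<in>UNIV. \<bar>\<Sum>i\<in>A. a i * coord (v i) k\<bar>)"
    by (simp add: norm_l1)
  also have "\<dots> = (\<Sum>k\<in>UNIV. \<Sum>i\<in>A. \<bar>a i * coord (v i) k\<bar>)"
    using assms by (intro sum.cong refl abs_sum_eq_sum_abs_if_products_zero) fastforce
  also have "\<dots> = (\<Sum>i\<in>A. \<Sum>k\<in>UNIV. \<bar>a i * coord (v i) k\<bar>)"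
    by (rule sum.swap)
  also have "\<dots> = (\<Sum>i\<in>A. \<bar>a i\<bar> * norm (v i))"
    by (simp add: norm_l1 abs_mult sum_distrib_left)
  finally show ?thesis .
qed


section \<open>Operators preserving orthogonality at the unit vectors\<close>

lemma scalar_multiple_of_isometryI:
  fixes T :: "'a::real_normed_vector \<Rightarrow> 'a"
  assumes lin: "linear T" and nrm: "\<And>x. norm (T x) = r * norm x"
  shows "scalar_multiple_of_isometry T"
proof (cases "r = 0")
  case True
  then have "T = (\<lambda>x. 0 *\<^sub>R id x)"
    using nrm by auto
  moreover have "linear_isometry (id :: 'a \<Rightarrow> 'a)"
    by (simp add: linear_isometry_def linear_id)
  ultimately show ?thesis
    unfolding scalar_multiple_of_isometry_def by blast
next
  case False
  have "norm ((1 / r) *\<^sub>R T x) = norm x" for x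
  proof (cases "x = 0")
    case True
    then show ?thesis
      using lin by (simp add: linear_0)
  next
    case nz: False
    \<comment> \<open>A norm cannot be negative, so the existence of a nonzero vector forces \<open>r > 0\<close>.\<close>
    have "0 \<le> r"
      using norm_ge_zero[of "T x"] nz by (simp add: nrm zero_le_mult_iff)
    then show ?thesis
      using False by (simp add: nrm)
  qed
  then have "linear_isometry (\<lambda>x. (1 / r) *\<^sub>R T x)"
    by (simp add: linear_isometry_def lin linear_compose_scale_right)
  moreover have "T = (\<lambda>x. r *\<^sub>R ((1 / r) *\<^sub>R T x))"
    using False by simp
  ultimately show ?thesis
    unfolding scalar_multiple_of_isometry_def by blast
qed

lemma unit_l1_bj_orthogonal:
  assumes "i \<noteq> j" and s: "\<bar>s\<bar> = 1"
  shows "unit_l1 i \<bottom>\<^sub>B unit_l1 i + s *\<^sub>R unit_l1 j"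
  unfolding bj_orthogonal_def
proof
  fix c :: real
  let ?z = "unit_l1 i + c *\<^sub>R (unit_l1 i + s *\<^sub>R unit_l1 j)"
  have "(\<Sum>k\<in>{i, j}. \<bar>coord ?z k\<bar>) \<le> norm ?z"
    unfolding norm_l1 by (rule sum_mono2) auto
  then have "\<bar>1 + c\<bar> + \<bar>c\<bar> \<le> norm ?z"
    using assms by (simp add: abs_mult)
  then show "norm (unit_l1 i) \<le> norm ?z"
    by simp
qed

text \<open>
  Only the relations \<open>e\<^sub>i \<bottom>\<^sub>B e\<^sub>i \<plusminus> e\<^sub>j\<close> have to be carried over by \<open>T\<close>: with the coefficients \<open>-1\<close> and
  \<open>-1/2\<close> they force the columns of \<open>T\<close> to have equal norms and pairwise disjoint supports.
\<close>

theorem preserves_bj_at_unit_l1_imp_scalar_multiple_of_isometry: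
  fixes T :: "'n::finite l1 \<Rightarrow> 'n l1"
  assumes lin: "linear T" and pres: "\<And>i. preserves_bj_at T (unit_l1 i)"
  shows "scalar_multiple_of_isometry T"
proof -
  define v where "v i = T (unit_l1 i)" for i
  have orth: "norm (v i) \<le> norm (v i + c *\<^sub>R (v i + s *\<^sub>R v j))"
    if "i \<noteq> j" "\<bar>s\<bar> = 1" for i j c s
    using pres[of i] unit_l1_bj_orthogonal[OF that]
    by (auto simp: preserves_bj_at_def bj_orthogonal_def v_def
        linear_add[OF lin] linear_cmul[OF lin])
  have le: "norm (v i) \<le> norm (v j)" for i j
  proof (cases "i = j")
    case False
    then show ?thesis
      using orth[of i j 1 "-1"] by simp
  qed simp
  have eq: "norm (v i) = norm (v j)" for i j
    using le[of i j] le[of j i] by simp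
  have disj: "coord (v i) k * coord (v j) k = 0" if "i \<noteq> j" for i j k
  proof -
    have half: "norm (v i) + norm (v j) \<le> norm (v i - s *\<^sub>R v j)" if s: "\<bar>s\<bar> = 1" for s
    proof -
      have "v i + (- 1 / 2) *\<^sub>R (v i + s *\<^sub>R v j) = (1 / 2) *\<^sub>R (v i - s *\<^sub>R v j)"
        by (rule l1_eqI) (simp add: field_simps)
      then have "norm (v i) \<le> norm (v i - s *\<^sub>R v j) / 2"
        using orth[OF \<open>i \<noteq> j\<close> s, of "- 1 / 2"] by simp
      then show ?thesis
        using eq[of i j] by simp
    qed
    show ?thesis
      using half[of 1] half[of "-1"] by (intro disjoint_supports_if_norm_additive) simp_all
  qed
  fix i0 :: 'n
  have "norm (T x) = norm (v i0) * norm x" for x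
  proof -
    have "T x = (\<Sum>i\<in>UNIV. coord x i *\<^sub>R v i)"
      by (subst unit_l1_expansion[of x, symmetric])
        (simp add: linear_sum[OF lin] linear_cmul[OF lin] v_def)
    then have "norm (T x) = (\<Sum>i\<in>UNIV. \<bar>coord x i\<bar> * norm (v i))"
      using norm_sum_disjoint_supports[of v "coord x" UNIV] disj by simp
    also have "\<dots> = (\<Sum>i\<in>UNIV. \<bar>coord x i\<bar> * norm (v i0))"
      by (intro sum.cong refl arg_cong2[where f = times] eq)
    also have "\<dots> = norm (v i0) * norm x"
      by (simp add: norm_l1[of x] sum_distrib_left mult.commute)
    finally show ?thesis .
  qed
  with lin show ?thesis
    by (rule scalar_multiple_of_isometryI)
qed


section \<open>The size of K-sets\<close>

lemma K_set_range_unit_l1: "K_set (range unit_l1 :: 'n::finite l1 set)"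
  unfolding K_set_def
  by (auto intro!: preserves_bj_at_unit_l1_imp_scalar_multiple_of_isometry bounded_linear.linear)

text \<open>
  With fewer than \<open>n\<close> points, some \<open>a \<noteq> 0\<close> is orthogonal to all of them in the Euclidean sense.
  The rank-one operator \<open>T y = (a \<bullet> y) a\<close> vanishes on \<open>A\<close>, and there it preserves orthogonality
  because \<open>0\<close> is orthogonal to everything.  If \<open>T = c S\<close> with \<open>S\<close> an isometry, then a unit vector in
  \<open>A\<close> gives \<open>c = 0\<close>, which contradicts \<open>T a = (a \<bullet> a) a \<noteq> 0\<close>.
\<close>

lemma K_set_card_ge:
  fixes A :: "'n::finite l1 set"
  assumes K: "K_set A" and fin: "finite A"
  shows "CARD('n) \<le> card A"
proof (rule ccontr)
  assume "\<not> CARD('n) \<le> card A"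
  moreover have "dim (vec_of_l1 ` A) \<le> card A"
    using fin by (meson card_image_le dim_le_card' finite_imageI le_trans)
  ultimately have "dim (vec_of_l1 ` A) < DIM(real ^ 'n)"
    by simp
  then obtain a :: "real ^ 'n"
    where a: "a \<noteq> 0" "\<And>y. y \<in> span (vec_of_l1 ` A) \<Longrightarrow> orthogonal a y"
    using orthogonal_to_subspace_exists by blast
  define f :: "'n l1 \<Rightarrow> real" where "f y = (\<Sum>i\<in>UNIV. a $ i * coord y i)" for y
  define T :: "'n l1 \<Rightarrow> 'n l1" where "T y = f y *\<^sub>R l1_of_vec a" for y
  have f_inner: "f y = a \<bullet> vec_of_l1 y" for y
    by (simp add: f_def coord_def inner_vec_def)
  have "\<bar>f y\<bar> \<le> norm y * (\<Sum>i\<in>UNIV. \<bar>a $ i\<bar>)" for y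
  proof -
    have "\<bar>f y\<bar> \<le> (\<Sum>i\<in>UNIV. \<bar>a $ i * coord y i\<bar>)"
      unfolding f_def by (rule sum_abs)
    also have "\<dots> \<le> (\<Sum>i\<in>UNIV. norm y * \<bar>a $ i\<bar>)"
      by (intro sum_mono)
        (simp add: abs_mult mult.commute[of "norm y"] mult_left_mono abs_coord_le_norm)
    finally show ?thesis
      by (simp add: sum_distrib_left)
  qed
  then have "bounded_linear f"
    by (intro bounded_linear_intro[where K = "\<Sum>i\<in>UNIV. \<bar>a $ i\<bar>"])
      (simp_all add: f_def algebra_simps sum.distrib sum_distrib_left)
  then have bl: "bounded_linear T"
    unfolding T_def by (rule bounded_linear_scaleR_const)
  have T0: "T x = 0" if "x \<in> A" for x
    using a(2)[of "vec_of_l1 x"] that by (simp add: T_def f_inner orthogonal_def span_base)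
  then have "preserves_bj_at T x" if "x \<in> A" for x
    using that by (simp add: preserves_bj_at_def bj_orthogonal_def)
  then obtain c S where S: "linear_isometry S" and T: "T = (\<lambda>x. c *\<^sub>R S x)"
    using K bl unfolding K_set_def scalar_multiple_of_isometry_def by blast
  obtain x where x: "x \<in> A" "norm x = 1"
    using K unfolding K_set_def by (metis all_not_in_conv mem_sphere_0 subsetD)
  have "\<bar>c\<bar> = norm (T x)"
    using S x by (simp add: T linear_isometry_def)
  then have "c = 0"
    using T0[OF x(1)] by (simp only: norm_zero abs_eq_0)
  then have "T (l1_of_vec a) = 0"
    by (simp add: T)
  moreover have "l1_of_vec a \<noteq> 0"
    using a(1) by (metis l1_of_vec_inverse UNIV_I zero_l1.rep_eq)
  ultimately have "a \<bullet> a = 0"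
    by (simp add: T_def f_inner l1_of_vec_inverse)
  with a(1) show False
    by simp
qed

lemma kappa_l1: "kappa TYPE('n::finite l1) = CARD('n)"
  unfolding kappa_def
proof (rule Least_equality)
  have "card (range unit_l1 :: 'n l1 set) = CARD('n)"
    by (rule card_image[OF inj_unit_l1])
  then show "\<exists>A :: 'n l1 set. K_set A \<and> finite A \<and> card A = CARD('n)"
    using K_set_range_unit_l1 by (intro exI[of _ "range unit_l1"]) simp
qed (use K_set_card_ge in blast)

theorem theorem2p22:
  shows "(\<forall>T :: 'n::finite l1 \<Rightarrow> 'n l1.
            linear T \<and> (\<forall>x. x extreme_point_of cball 0 1 \<longrightarrow> preserves_bj_at T x)
              \<longrightarrow> scalar_multiple_of_isometry T)
       \<and> ((\<exists>A :: 'n l1 set. K_set A \<and> finite A) \<and> kappa TYPE('n l1) = CARD('n))"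
proof (intro conjI allI impI)
  fix T :: "'n l1 \<Rightarrow> 'n l1"
  assume "linear T \<and> (\<forall>x. x extreme_point_of cball 0 1 \<longrightarrow> preserves_bj_at T x)"
  then show "scalar_multiple_of_isometry T"
    using unit_l1_extreme_point preserves_bj_at_unit_l1_imp_scalar_multiple_of_isometry by blast
next
  show "\<exists>A :: 'n l1 set. K_set A \<and> finite A"
    using K_set_range_unit_l1 by (intro exI[of _ "range unit_l1"]) simp
qed (rule kappa_l1)

end
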